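(* Let $k$ be a field of any characteristic, let $V$ be a finite-dimensional vector space over $k$, and let $d$ be a nonnegative integer. Let $\varphi,\phi:V\to V$ be linear maps, let $w\in V$ be an eigenvector of $\varphi$ and let $v\in V$ be an eigenvector of $\phi$. If there exists an invertible linear map $T\in \mathrm{GL}(V)$ such that $\phi=T\circ\varphi\circ T^{-1}$ and $v=T(w)$, then the Lie algebras $\mathfrak{g}_{\varphi}^{w}(d)$ and $\mathfrak{g}_{\phi}^{v}(d)$ are isomorphic.
   Context: $S^d(V^* )$ denotes the $d$-th symmetric power of the dual space $V^*$. Choosing a basis of $V$ with dual basis $x_1,\dots,x_n$ of $V^*$, it is identified with the space of homogeneous polynomials of degree $d$ in $k[x_1,\dots,x_n]$; elements $f$ are evaluated at vectors $v\in V$, giving $f(v)\in k$. For a linear map $\varphi:V\to V$, $\varphi_d^*:S^d(V^* )\to S^d(V^* )$ denotes the linear map induced by $\varphi$, i.e. $\varphi_d^*(f)=f\circ\varphi$ (substituting $x_i\mapsto x_i\circ\varphi\in V^*$). For an eigenvector $w$ of $\varphi$, $\mathfrak{g}_{\varphi}^{w}(d)$ denotes the Lie algebra with underlying vector space $S^d(V^* )$ and bracket $[f,g]:=g(w)\,\varphi_d^*(f)-f(w)\,\varphi_d^*(g)$ for $f,g\in S^d(V^* )$. *)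

theory Defs
  imports Complex_Main "HOL-Library.Poly_Mapping"
begin

section \<open>Lie algebras over a field\<close>

text \<open>The underlying vector space of a Lie algebra is a subspace \<open>elems\<close> of an ambient type,
  whose addition it inherits; \<open>smul\<close> and \<open>br\<close> are only constrained on \<open>elems\<close>.\<close>

record ('k, 'a) lie_alg =
  elems :: "'a set"
  smul :: "'k \<Rightarrow> 'a \<Rightarrow> 'a"
  br :: "'a \<Rightarrow> 'a \<Rightarrow> 'a"

locale lie_algebra =
  fixes L :: "('k::field, 'a::ab_group_add) lie_alg"
  assumes zero_closed: "0 \<in> elems L"
    and add_closed: "\<lbrakk>x \<in> elems L; y \<in> elems L\<rbrakk> \<Longrightarrow> x + y \<in> elems L"
    and smul_closed: "x \<in> elems L \<Longrightarrow> smul L c x \<in> elems L"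
    and br_closed: "\<lbrakk>x \<in> elems L; y \<in> elems L\<rbrakk> \<Longrightarrow> br L x y \<in> elems L"
    and smul_add_right: "\<lbrakk>x \<in> elems L; y \<in> elems L\<rbrakk> \<Longrightarrow> smul L c (x + y) = smul L c x + smul L c y"
    and smul_add_left: "x \<in> elems L \<Longrightarrow> smul L (b + c) x = smul L b x + smul L c x"
    and smul_smul: "x \<in> elems L \<Longrightarrow> smul L b (smul L c x) = smul L (b * c) x"
    and smul_one: "x \<in> elems L \<Longrightarrow> smul L 1 x = x"
    and br_add_left: "\<lbrakk>x \<in> elems L; y \<in> elems L; z \<in> elems L\<rbrakk>
      \<Longrightarrow> br L (x + y) z = br L x z + br L y z"
    and br_add_right: "\<lbrakk>x \<in> elems L; y \<in> elems L; z \<in> elems L\<rbrakk>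
      \<Longrightarrow> br L x (y + z) = br L x y + br L x z"
    and br_smul_left: "\<lbrakk>x \<in> elems L; y \<in> elems L\<rbrakk> \<Longrightarrow> br L (smul L c x) y = smul L c (br L x y)"
    and br_smul_right: "\<lbrakk>x \<in> elems L; y \<in> elems L\<rbrakk> \<Longrightarrow> br L x (smul L c y) = smul L c (br L x y)"
    and br_self: "x \<in> elems L \<Longrightarrow> br L x x = 0"
    and jacobi: "\<lbrakk>x \<in> elems L; y \<in> elems L; z \<in> elems L\<rbrakk>
      \<Longrightarrow> br L (br L x y) z + br L (br L y z) x + br L (br L z x) y = 0"

definition lie_iso :: "('k::field, 'a::ab_group_add) lie_alg \<Rightarrow> ('k, 'b::ab_group_add) lie_alg
    \<Rightarrow> ('a \<Rightarrow> 'b) \<Rightarrow> bool" where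
  "lie_iso L M h \<longleftrightarrow> bij_betw h (elems L) (elems M) \<and>
     (\<forall>x\<in>elems L. \<forall>y\<in>elems L. h (x + y) = h x + h y) \<and>
     (\<forall>c. \<forall>x\<in>elems L. h (smul L c x) = smul M c (h x)) \<and>
     (\<forall>x\<in>elems L. \<forall>y\<in>elems L. h (br L x y) = br M (h x) (h y))"

definition lie_isomorphic :: "('k::field, 'a::ab_group_add) lie_alg
    \<Rightarrow> ('k, 'b::ab_group_add) lie_alg \<Rightarrow> bool" where
  "lie_isomorphic L M \<longleftrightarrow> lie_algebra L \<and> lie_algebra M \<and> (\<exists>h. lie_iso L M h)"


section \<open>Linear maps and eigenvectors\<close>

definition eigenvector :: "('k::field \<Rightarrow> 'v::ab_group_add \<Rightarrow> 'v) \<Rightarrow> ('v \<Rightarrow> 'v) \<Rightarrow> 'v \<Rightarrow> bool" where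
  "eigenvector scale \<phi> w \<longleftrightarrow> w \<noteq> 0 \<and> (\<exists>c. \<phi> w = scale c w)"

definition GL :: "('k::field \<Rightarrow> 'v::ab_group_add \<Rightarrow> 'v) \<Rightarrow> ('v \<Rightarrow> 'v) set" where
  "GL scale = {T. Vector_Spaces.linear scale scale T \<and> bij T}"


section \<open>Polynomials in the coordinates of a basis\<close>

text \<open>A formal polynomial (not a polynomial function, so that finite fields are covered) with
  one variable for each element of the type \<open>'v\<close>: a finitely supported map from exponent vectors
  to coefficients. For a basis \<open>B\<close>, the variable with index \<open>b \<in> B\<close> stands for the dual basis
  vector \<open>coord scale B b\<close>; polynomials in \<open>sym_power B d\<close> use no other variables.\<close>

type_synonym ('v, 'k) mpoly = "('v \<Rightarrow>\<^sub>0 nat) \<Rightarrow>\<^sub>0 'k"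

definition const :: "'k::comm_ring_1 \<Rightarrow> ('v, 'k) mpoly" where
  "const c = Poly_Mapping.single 0 c"

definition var :: "'v \<Rightarrow> ('v, 'k::comm_ring_1) mpoly" where
  "var b = Poly_Mapping.single (Poly_Mapping.single b 1) 1"

text \<open>\<open>extend_hom \<iota> \<sigma>\<close> is the ring homomorphism that acts as \<open>\<iota>\<close> on coefficients and sends the
  variable with index \<open>b\<close> to \<open>\<sigma> b\<close>; it is used both to evaluate and to substitute.\<close>

definition extend_hom :: "('k::comm_ring_1 \<Rightarrow> 'r::comm_ring_1) \<Rightarrow> ('v \<Rightarrow> 'r) \<Rightarrow> ('v, 'k) mpoly \<Rightarrow> 'r"
  where "extend_hom \<iota> \<sigma> p =
    (\<Sum>m\<in>Poly_Mapping.keys p. \<iota> (Poly_Mapping.lookup p m) *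
       (\<Prod>b\<in>Poly_Mapping.keys m. \<sigma> b ^ Poly_Mapping.lookup m b))"

definition sym_power :: "'v set \<Rightarrow> nat \<Rightarrow> ('v, 'k::comm_ring_1) mpoly set" where
  "sym_power B d = {p. \<forall>m\<in>Poly_Mapping.keys p. Poly_Mapping.keys m \<subseteq> B \<and>
     (\<Sum>b\<in>Poly_Mapping.keys m. Poly_Mapping.lookup m b) = d}"

definition coord :: "('k::field \<Rightarrow> 'v::ab_group_add \<Rightarrow> 'v) \<Rightarrow> 'v set \<Rightarrow> 'v \<Rightarrow> 'v \<Rightarrow> 'k" where
  "coord scale B b v = module.representation scale B v b"

definition eval_at :: "('k::field \<Rightarrow> 'v::ab_group_add \<Rightarrow> 'v) \<Rightarrow> 'v set \<Rightarrow> ('v, 'k) mpoly \<Rightarrow> 'v \<Rightarrow> 'k"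
  where "eval_at scale B f v = extend_hom (\<lambda>c. c) (\<lambda>b. coord scale B b v) f"

text \<open>The element of \<open>sym_power B 1\<close> corresponding to a linear functional.\<close>

definition linear_form :: "'v set \<Rightarrow> ('v \<Rightarrow> 'k::comm_ring_1) \<Rightarrow> ('v, 'k) mpoly" where
  "linear_form B \<xi> = (\<Sum>c\<in>B. const (\<xi> c) * var c)"

definition pullback :: "('k::field \<Rightarrow> 'v::ab_group_add \<Rightarrow> 'v) \<Rightarrow> 'v set \<Rightarrow> ('v \<Rightarrow> 'v)
    \<Rightarrow> ('v, 'k) mpoly \<Rightarrow> ('v, 'k) mpoly" where
  "pullback scale B \<phi> f = extend_hom const (\<lambda>b. linear_form B (coord scale B b \<circ> \<phi>)) f"

definition g_alg :: "('k::field \<Rightarrow> 'v::ab_group_add \<Rightarrow> 'v) \<Rightarrow> 'v set \<Rightarrow> ('v \<Rightarrow> 'v) \<Rightarrow> 'v \<Rightarrow> nat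
    \<Rightarrow> ('k, ('v, 'k) mpoly) lie_alg" where
  "g_alg scale B \<phi> w d =
    \<lparr> elems = sym_power B d,
      smul = (\<lambda>c f. const c * f),
      br = (\<lambda>f g. const (eval_at scale B g w) * pullback scale B \<phi> f
                - const (eval_at scale B f w) * pullback scale B \<phi> g) \<rparr>"


section \<open>The bracket makes \<open>sym_power B d\<close> a Lie algebra\<close>

lemma const_simps [simp]:
  "const 0 = 0" "const 1 = 1" "const (a + b) = const a + const b"
  "const (a - b) = const a - const b" "const (a * b) = const a * const b"
  by (simp_all add: const_def single_add single_diff mult_single)

locale coeff_hom =
  fixes \<iota> :: "'k::comm_ring_1 \<Rightarrow> 'r::comm_ring_1"
  assumes hom_0: "\<iota> 0 = 0" and hom_1: "\<iota> 1 = 1"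
    and hom_add: "\<iota> (a + b) = \<iota> a + \<iota> b" and hom_mult: "\<iota> (a * b) = \<iota> a * \<iota> b"

interpretation id_hom: coeff_hom "\<lambda>c. c :: 'k::comm_ring_1"
  by unfold_locales simp_all

interpretation const_hom: coeff_hom "const :: 'k::comm_ring_1 \<Rightarrow> ('v, 'k) mpoly"
  by unfold_locales simp_all

definition mono_val :: "('v \<Rightarrow> 'r::comm_ring_1) \<Rightarrow> ('v \<Rightarrow>\<^sub>0 nat) \<Rightarrow> 'r" where
  "mono_val \<sigma> m = (\<Prod>b\<in>Poly_Mapping.keys m. \<sigma> b ^ Poly_Mapping.lookup m b)"

lemma mono_val_superset:
  assumes "finite S" "Poly_Mapping.keys m \<subseteq> S"
  shows "mono_val \<sigma> m = (\<Prod>b\<in>S. \<sigma> b ^ Poly_Mapping.lookup m b)"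
  unfolding mono_val_def using assms
  by (intro prod.mono_neutral_left) (auto simp: in_keys_iff)

lemma mono_val_0 [simp]: "mono_val \<sigma> 0 = 1"
  by (simp add: mono_val_def)

lemma mono_val_single [simp]: "mono_val \<sigma> (Poly_Mapping.single b n) = \<sigma> b ^ n"
  by (simp add: mono_val_superset[of "{b}"])

lemma mono_val_add: "mono_val \<sigma> (m + n) = mono_val \<sigma> m * mono_val \<sigma> n"
proof -
  let ?S = "Poly_Mapping.keys m \<union> Poly_Mapping.keys n"
  have "Poly_Mapping.keys (m + n) \<subseteq> ?S" by (rule Poly_Mapping.keys_add)
  then show ?thesis
    by (simp add: mono_val_superset[of ?S] lookup_add power_add prod.distrib)
qed

lemma poly_mapping_sum_single:
  "p = (\<Sum>m\<in>Poly_Mapping.keys p. Poly_Mapping.single m (Poly_Mapping.lookup p m))"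
proof (rule poly_mapping_eqI)
  fix k
  show "Poly_Mapping.lookup p k = Poly_Mapping.lookup
      (\<Sum>m\<in>Poly_Mapping.keys p. Poly_Mapping.single m (Poly_Mapping.lookup p m)) k"
    by (simp add: lookup_sum lookup_single when_def in_keys_iff)
qed

lemma poly_mapping_induct_add [case_names zero single add]:
  assumes "P 0" "\<And>m a. P (Poly_Mapping.single m a)" "\<And>p q. P p \<Longrightarrow> P q \<Longrightarrow> P (p + q)"
  shows "P (p :: 'a \<Rightarrow>\<^sub>0 'b::comm_monoid_add)"
proof -
  have "P (\<Sum>m\<in>A. Poly_Mapping.single m (Poly_Mapping.lookup p m))" if "finite A" for A
    using that by induction (auto intro: assms)
  then show ?thesis
    using poly_mapping_sum_single[of p] by (metis finite_keys)
qed

context coeff_hom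
begin

lemma extend_hom_eq:
  "extend_hom \<iota> \<sigma> p = (\<Sum>m\<in>Poly_Mapping.keys p. \<iota> (Poly_Mapping.lookup p m) * mono_val \<sigma> m)"
  by (simp add: extend_hom_def mono_val_def)

lemma extend_hom_0 [simp]: "extend_hom \<iota> \<sigma> 0 = 0"
  by (simp add: extend_hom_def)

lemma extend_hom_single: "extend_hom \<iota> \<sigma> (Poly_Mapping.single m a) = \<iota> a * mono_val \<sigma> m"
  by (simp add: extend_hom_eq hom_0)

lemma extend_hom_const [simp]: "extend_hom \<iota> \<sigma> (const c) = \<iota> c"
  by (simp add: const_def extend_hom_single)

lemma extend_hom_var [simp]: "extend_hom \<iota> \<sigma> (var b) = \<sigma> b"
  by (simp add: var_def extend_hom_single hom_1)

lemma extend_hom_1 [simp]: "extend_hom \<iota> \<sigma> 1 = 1"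
  using extend_hom_const[of \<sigma> 1] by (simp add: hom_1)

lemma extend_hom_add: "extend_hom \<iota> \<sigma> (p + q) = extend_hom \<iota> \<sigma> p + extend_hom \<iota> \<sigma> q"
  unfolding extend_hom_eq
  by (rule setsum_keys_plus_distrib) (auto simp: hom_0 hom_add algebra_simps)

lemma extend_hom_mult: "extend_hom \<iota> \<sigma> (p * q) = extend_hom \<iota> \<sigma> p * extend_hom \<iota> \<sigma> q"
proof (induction p rule: poly_mapping_induct_add)
  case (single m a)
  show ?case
    by (induction q rule: poly_mapping_induct_add)
      (simp_all add: extend_hom_add extend_hom_single mult_single mono_val_add hom_mult
        algebra_simps)
qed (simp_all add: extend_hom_add algebra_simps)

lemma extend_hom_diff: "extend_hom \<iota> \<sigma> (p - q) = extend_hom \<iota> \<sigma> p - extend_hom \<iota> \<sigma> q"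
  using extend_hom_add[of \<sigma> "p - q" q] by simp

lemma extend_hom_sum: "extend_hom \<iota> \<sigma> (\<Sum>i\<in>A. f i) = (\<Sum>i\<in>A. extend_hom \<iota> \<sigma> (f i))"
  by (induction A rule: infinite_finite_induct) (simp_all add: extend_hom_add)

lemma extend_hom_power: "extend_hom \<iota> \<sigma> (p ^ n) = extend_hom \<iota> \<sigma> p ^ n"
  by (induction n) (simp_all add: extend_hom_mult)

lemma extend_hom_prod: "extend_hom \<iota> \<sigma> (\<Prod>i\<in>A. f i) = (\<Prod>i\<in>A. extend_hom \<iota> \<sigma> (f i))"
  by (induction A rule: infinite_finite_induct) (simp_all add: extend_hom_mult)

lemma extend_hom_extend_hom:
  "extend_hom \<iota> \<sigma> (extend_hom const \<tau> p) = extend_hom \<iota> (\<lambda>b. extend_hom \<iota> \<sigma> (\<tau> b)) p"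
  unfolding extend_hom_def[of const \<tau>]
  by (simp add: extend_hom_sum extend_hom_mult extend_hom_prod extend_hom_power
      extend_hom_def[of \<iota> "\<lambda>b. extend_hom \<iota> \<sigma> (\<tau> b)"])

end

lemma extend_hom_cong:
  assumes "p \<in> sym_power B d" "\<And>b. b \<in> B \<Longrightarrow> \<sigma> b = \<tau> b"
  shows "extend_hom \<iota> \<sigma> p = extend_hom \<iota> \<tau> p"
  unfolding extend_hom_def using assms
  by (intro sum.cong refl arg_cong2[where f = "(*)"] prod.cong) (force simp: sym_power_def)+

lemma sym_power_0 [simp]: "0 \<in> sym_power B d"
  by (simp add: sym_power_def)

lemma sym_power_add: "p \<in> sym_power B d \<Longrightarrow> q \<in> sym_power B d \<Longrightarrow> p + q \<in> sym_power B d"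
  using Poly_Mapping.keys_add[of p q] by (auto simp: sym_power_def)

lemma sym_power_sum: "(\<And>i. i \<in> A \<Longrightarrow> f i \<in> sym_power B d) \<Longrightarrow> (\<Sum>i\<in>A. f i) \<in> sym_power B d"
  by (induction A rule: infinite_finite_induct) (auto intro: sym_power_add)

lemma total_degree_add:
  fixes m n :: "'v \<Rightarrow>\<^sub>0 nat"
  shows "(\<Sum>b\<in>Poly_Mapping.keys (m + n). Poly_Mapping.lookup (m + n) b)
    = (\<Sum>b\<in>Poly_Mapping.keys m. Poly_Mapping.lookup m b)
      + (\<Sum>b\<in>Poly_Mapping.keys n. Poly_Mapping.lookup n b)"
  by (rule setsum_keys_plus_distrib) simp_all

lemma sym_power_mult:
  assumes "p \<in> sym_power B d" "q \<in> sym_power B e"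
  shows "p * q \<in> sym_power B (d + e)"
  unfolding sym_power_def
proof (intro CollectI ballI)
  fix k assume "k \<in> Poly_Mapping.keys (p * q)"
  then obtain m n where k: "k = m + n" and m: "m \<in> Poly_Mapping.keys p"
    and n: "n \<in> Poly_Mapping.keys q"
    using keys_mult[of p q] by blast
  show "Poly_Mapping.keys k \<subseteq> B \<and>
      (\<Sum>b\<in>Poly_Mapping.keys k. Poly_Mapping.lookup k b) = d + e"
    using assms m n Poly_Mapping.keys_add[of m n]
    unfolding k total_degree_add sym_power_def by (smt (verit) Un_iff mem_Collect_eq subset_eq)
qed

lemma sym_power_const: "const c \<in> sym_power B 0"
  by (simp add: sym_power_def const_def)

lemma sym_power_smul: "p \<in> sym_power B d \<Longrightarrow> const c * p \<in> sym_power B d"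
  using sym_power_mult[OF sym_power_const] by fastforce

lemma sym_power_diff:
  assumes "p \<in> sym_power B d" "q \<in> sym_power B d"
  shows "p - q \<in> sym_power B d"
proof -
  have "const (- 1) * q = - q"
    using const_simps(4)[of 0 1] by (metis const_simps(1,2) diff_0 mult_minus1)
  then show ?thesis
    using sym_power_add[OF assms(1) sym_power_smul[OF assms(2), of "- 1"]] by simp
qed

lemma sym_power_power: "p \<in> sym_power B d \<Longrightarrow> p ^ n \<in> sym_power B (n * d)"
proof (induction n)
  case 0
  then show ?case using sym_power_const[of 1] by simp
next
  case (Suc n)
  then show ?case using sym_power_mult[of p B d "p ^ n" "n * d"] by simp
qed

lemma sym_power_prod:
  assumes "finite A" "\<And>i. i \<in> A \<Longrightarrow> f i \<in> sym_power B (e i)"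
  shows "(\<Prod>i\<in>A. f i) \<in> sym_power B (\<Sum>i\<in>A. e i)"
  using assms
proof (induction A rule: finite_induct)
  case empty
  then show ?case using sym_power_const[of 1] by simp
qed (auto intro: sym_power_mult)

lemma linear_form_in_sym_power: "linear_form B \<xi> \<in> sym_power B 1"
proof -
  have "var c \<in> sym_power B 1" if "c \<in> B" for c
    using that by (simp add: sym_power_def var_def)
  then show ?thesis
    unfolding linear_form_def by (intro sym_power_sum sym_power_smul)
qed

lemma pullback_in_sym_power:
  assumes "f \<in> sym_power B d"
  shows "pullback scale B \<phi> f \<in> sym_power B d"
  unfolding pullback_def extend_hom_def
proof (intro sym_power_sum sym_power_smul)
  fix m assume m: "m \<in> Poly_Mapping.keys f"
  let ?\<sigma> = "\<lambda>b. linear_form B (coord scale B b \<circ> \<phi>)"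
  have "(\<Prod>b\<in>Poly_Mapping.keys m. ?\<sigma> b ^ Poly_Mapping.lookup m b)
      \<in> sym_power B (\<Sum>b\<in>Poly_Mapping.keys m. Poly_Mapping.lookup m b)"
    by (rule sym_power_prod) (use sym_power_power[OF linear_form_in_sym_power] in auto)
  then show "(\<Prod>b\<in>Poly_Mapping.keys m. ?\<sigma> b ^ Poly_Mapping.lookup m b) \<in> sym_power B d"
    using assms m by (simp add: sym_power_def[of B d])
qed

lemma pullback_simps:
  "pullback scale B \<phi> (f + g) = pullback scale B \<phi> f + pullback scale B \<phi> g"
  "pullback scale B \<phi> (f - g) = pullback scale B \<phi> f - pullback scale B \<phi> g"
  "pullback scale B \<phi> (f * g) = pullback scale B \<phi> f * pullback scale B \<phi> g"
  "pullback scale B \<phi> (const c) = const c"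
  by (simp_all add: pullback_def const_hom.extend_hom_add const_hom.extend_hom_diff
      const_hom.extend_hom_mult)

lemma eval_at_simps:
  "eval_at scale B (f + g) v = eval_at scale B f v + eval_at scale B g v"
  "eval_at scale B (f - g) v = eval_at scale B f v - eval_at scale B g v"
  "eval_at scale B (f * g) v = eval_at scale B f v * eval_at scale B g v"
  "eval_at scale B (const c) v = c"
  by (simp_all add: eval_at_def id_hom.extend_hom_add id_hom.extend_hom_diff
      id_hom.extend_hom_mult)

context finite_dimensional_vector_space
begin

lemma linear_coord: "Vector_Spaces.linear scale (*) (coord scale Basis b)"
  unfolding coord_def using linear_representation[OF independent_Basis span_Basis] .

lemma eval_linear_form:
  assumes "Vector_Spaces.linear scale (*) \<xi>"
  shows "eval_at scale Basis (linear_form Basis \<xi>) v = \<xi> v"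
proof -
  interpret \<xi>: Vector_Spaces.linear scale "(*)" \<xi> by fact
  have "\<xi> v = \<xi> (\<Sum>b\<in>Basis. scale (representation Basis v b) b)"
    by (simp add: sum_representation_eq independent_Basis span_Basis finite_Basis)
  then show ?thesis
    by (simp add: eval_at_def linear_form_def id_hom.extend_hom_sum id_hom.extend_hom_mult
        \<xi>.sum \<xi>.scale coord_def mult.commute)
qed

text \<open>The pullback of \<open>f\<close> along \<open>\<phi>\<close> evaluates like the composition of \<open>f\<close> and \<open>\<phi>\<close>.\<close>

lemma eval_pullback:
  assumes "Vector_Spaces.linear scale scale \<phi>"
  shows "eval_at scale Basis (pullback scale Basis \<phi> f) v = eval_at scale Basis f (\<phi> v)"
proof -
  have "eval_at scale Basis (linear_form Basis (coord scale Basis b \<circ> \<phi>)) v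
      = coord scale Basis b (\<phi> v)" for b
    using eval_linear_form[OF Vector_Spaces.linear_compose[OF assms linear_coord]] by simp
  then show ?thesis
    by (simp add: eval_at_def pullback_def id_hom.extend_hom_extend_hom)
qed

lemma eval_scale:
  assumes "f \<in> sym_power Basis d"
  shows "eval_at scale Basis f (scale c v) = c ^ d * eval_at scale Basis f v"
proof -
  have "coord scale Basis b (scale c v) = c * coord scale Basis b v" for b
    by (simp add: coord_def representation_scale independent_Basis span_Basis)
  moreover have "(\<Sum>b\<in>Poly_Mapping.keys m. Poly_Mapping.lookup m b) = d"
    if "m \<in> Poly_Mapping.keys f" for m
    using assms that by (simp add: sym_power_def)
  ultimately show ?thesis
    by (simp add: eval_at_def extend_hom_def power_mult_distrib prod.distrib sum_distrib_left
        flip: power_sum) (simp add: mult.left_commute)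
qed

lemma lie_algebra_g_alg:
  assumes "Vector_Spaces.linear scale scale \<phi>" "eigenvector scale \<phi> w"
  shows "lie_algebra (g_alg scale Basis \<phi> w d)"
proof -
  obtain c where c: "\<phi> w = scale c w"
    using assms(2) by (auto simp: eigenvector_def)
  have ev: "eval_at scale Basis (pullback scale Basis \<phi> f) w = c ^ d * eval_at scale Basis f w"
    if "f \<in> sym_power Basis d" for f
    using that by (simp add: eval_pullback assms(1) c eval_scale)
  have smul': "f * const a \<in> sym_power Basis d" if "f \<in> sym_power Basis d"
    for f :: "('b, 'a) mpoly" and a
    using sym_power_smul[OF that] by (simp add: mult.commute)
  show ?thesis
    by unfold_locales
      (auto simp: g_alg_def pullback_simps eval_at_simps ev algebra_simps
        intro!: sym_power_add smul' sym_power_diff pullback_in_sym_power)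
qed

end

end

theory Submission
  imports Defs
begin

text \<open>The isomorphism is the change of variables \<open>f \<mapsto> f \<circ> T\<inverse>\<close>, the pullback along the inverse
  of \<open>T\<close>. Everything rests on pullback being a contravariant functor on symmetric powers
  (\<open>pullback_pullback\<close> and \<open>pullback_id\<close>). Functoriality makes pullback along \<open>T\<close> its inverse, and
  the two ingredients of the bracket are carried over separately: \<open>(f \<circ> T\<inverse>)(v) = f(w)\<close> because
  \<open>T w = v\<close>, and \<open>(f \<circ> T\<inverse>) \<circ> \<psi> = (f \<circ> \<phi>) \<circ> T\<inverse>\<close> because \<open>T\<inverse> \<circ> \<psi> = \<phi> \<circ> T\<inverse>\<close>.

  The elements of the symmetric power are formal polynomials, which over a finite field
  need not be determined by their values; so functoriality is derived from substitution into the
  variables and not from evaluation.\<close>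

lemma mono_val_var: "mono_val (var :: 'v \<Rightarrow> ('v, 'k::comm_ring_1) mpoly) m = Poly_Mapping.single m 1"
proof (induction m rule: poly_mapping_induct_add)
  case (single b n)
  have "var b ^ n = (Poly_Mapping.single (Poly_Mapping.single b n) 1 :: ('v, 'k) mpoly)"
    by (induction n) (simp_all add: var_def mult_single flip: single_add)
  then show ?case by simp
qed (simp_all add: mono_val_add mult_single)

lemma extend_hom_const_var: "extend_hom const var p = p"
proof (induction p rule: poly_mapping_induct_add)
  case (single m a)
  show ?case
    unfolding const_hom.extend_hom_single mono_val_var by (simp add: const_def mult_single)
qed (simp_all add: const_hom.extend_hom_add)

lemma linear_inv_of_GL:
  assumes "vector_space scale" "T \<in> GL scale"
  shows "Vector_Spaces.linear scale scale (inv T)"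
proof -
  interpret vector_space scale by fact
  interpret T: Vector_Spaces.linear scale scale T
    using assms(2) by (simp add: GL_def)
  have T: "bij T" using assms(2) by (simp add: GL_def)
  have cancel: "inv T (T x) = x" "T (inv T x) = x" for x
    using T by (simp_all add: bij_is_inj bij_is_surj surj_f_inv_f)
  show ?thesis
  proof unfold_locales
    show "inv T (x + y) = inv T x + inv T y" for x y
      using cancel by (metis T.add)
    show "inv T (scale c x) = scale c (inv T x)" for c x
      using cancel by (metis T.scale)
  qed
qed

context finite_dimensional_vector_space
begin

lemma linear_form_coord:
  assumes "b \<in> Basis"
  shows "linear_form Basis (coord scale Basis b) = var b"
proof -
  have "linear_form Basis (coord scale Basis b)
      = (\<Sum>c\<in>Basis. if c = b then var c else (0 :: ('b, 'a) mpoly))"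
    unfolding linear_form_def
    by (intro sum.cong) (auto simp: coord_def representation_basis independent_Basis)
  then show ?thesis
    using assms finite_Basis by simp
qed

text \<open>Substitution produces, as coefficient of \<open>var b\<close>, the expansion of \<open>\<xi> (\<phi> b)\<close> over the
  coordinates of the vector \<open>\<phi> b\<close>; linearity of \<open>\<xi>\<close> collapses it.\<close>

lemma pullback_linear_form:
  assumes "Vector_Spaces.linear scale (*) \<xi>"
  shows "pullback scale Basis \<phi> (linear_form Basis \<xi>) = linear_form Basis (\<xi> \<circ> \<phi>)"
proof -
  have const_sum: "const (sum g A) = (\<Sum>c\<in>A. const (g c))" for g :: "'b \<Rightarrow> 'a" and A
    by (induction A rule: infinite_finite_induct) simp_all
  have expand: "\<xi> u = (\<Sum>c\<in>Basis. \<xi> c * coord scale Basis c u)" for u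
    using eval_linear_form[OF assms, of u]
    by (simp add: eval_at_def linear_form_def id_hom.extend_hom_sum id_hom.extend_hom_mult)
  have "pullback scale Basis \<phi> (linear_form Basis \<xi>)
      = (\<Sum>c\<in>Basis. const (\<xi> c) * linear_form Basis (coord scale Basis c \<circ> \<phi>))"
    by (simp add: pullback_def linear_form_def[of _ \<xi>] const_hom.extend_hom_sum
        const_hom.extend_hom_mult)
  also have "\<dots> = (\<Sum>b\<in>Basis. \<Sum>c\<in>Basis. const (\<xi> c * coord scale Basis c (\<phi> b)) * var b)"
    unfolding linear_form_def sum_distrib_left
    by (subst sum.swap) (simp add: mult.assoc)
  also have "\<dots> = (\<Sum>b\<in>Basis. const (\<xi> (\<phi> b)) * var b)"
    by (intro sum.cong refl) (simp only: expand[of "\<phi> _"] const_sum sum_distrib_right)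
  finally show ?thesis
    by (simp add: linear_form_def)
qed

text \<open>Both sides are ring homomorphisms that fix the constants, so it suffices to compare them on
  variables, where they are given by linear forms.\<close>

lemma pullback_pullback:
  assumes "Vector_Spaces.linear scale scale \<psi>"
  shows "pullback scale Basis \<phi> (pullback scale Basis \<psi> f) = pullback scale Basis (\<psi> \<circ> \<phi>) f"
proof -
  have "pullback scale Basis \<phi> (linear_form Basis (coord scale Basis b \<circ> \<psi>))
      = linear_form Basis (coord scale Basis b \<circ> (\<psi> \<circ> \<phi>))" for b
    using pullback_linear_form[OF Vector_Spaces.linear_compose[OF assms linear_coord]]
    by (simp add: comp_assoc)
  then show ?thesis
    by (simp add: pullback_def const_hom.extend_hom_extend_hom)
qed

text \<open>The restriction to \<open>sym_power\<close> matters: a variable whose index lies outside the basis is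
  sent to 0, since its coordinate function vanishes.\<close>

lemma pullback_id:
  assumes "f \<in> sym_power Basis d"
  shows "pullback scale Basis id f = f"
proof -
  have "pullback scale Basis id f = extend_hom const var f"
    unfolding pullback_def
    by (rule extend_hom_cong[OF assms]) (simp add: linear_form_coord)
  then show ?thesis
    by (simp add: extend_hom_const_var)
qed

lemma bij_betw_pullback:
  assumes "Vector_Spaces.linear scale scale S" "Vector_Spaces.linear scale scale T"
    and "S \<circ> T = id" "T \<circ> S = id"
  shows "bij_betw (pullback scale Basis S) (sym_power Basis d) (sym_power Basis d)"
  by (rule bij_betw_byWitness[where f' = "pullback scale Basis T"])
    (auto simp: pullback_pullback assms pullback_id intro: pullback_in_sym_power)

text \<open>The scalar coefficients of the two brackets match because \<open>S v = w\<close>, the polynomial factors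
  because \<open>S \<circ> \<psi> = \<phi> \<circ> S\<close>.\<close>

lemma pullback_br:
  assumes "Vector_Spaces.linear scale scale S" "Vector_Spaces.linear scale scale \<phi>"
    and "S \<circ> \<psi> = \<phi> \<circ> S" "S v = w"
  shows "pullback scale Basis S (br (g_alg scale Basis \<phi> w d) f g)
    = br (g_alg scale Basis \<psi> v d) (pullback scale Basis S f) (pullback scale Basis S g)"
  using assms
  by (simp add: g_alg_def pullback_simps eval_pullback pullback_pullback)

end

theorem theorem4p1:
  fixes scale :: "'k::field \<Rightarrow> 'v::ab_group_add \<Rightarrow> 'v"
    and B :: "'v set"
    and \<phi> \<psi> :: "'v \<Rightarrow> 'v"
    and w v :: 'v
    and d :: nat
  assumes "finite_dimensional_vector_space scale B"
    and "Vector_Spaces.linear scale scale \<phi>"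
    and "Vector_Spaces.linear scale scale \<psi>"
    and "eigenvector scale \<phi> w"
    and "eigenvector scale \<psi> v"
    and "\<exists>T\<in>GL scale. \<psi> = T \<circ> \<phi> \<circ> inv T \<and> v = T w"
  shows "lie_isomorphic (g_alg scale B \<phi> w d) (g_alg scale B \<psi> v d)"
proof -
  interpret finite_dimensional_vector_space scale B by fact
  obtain T where T: "T \<in> GL scale" and \<psi>: "\<psi> = T \<circ> \<phi> \<circ> inv T" and v: "v = T w"
    using assms(6) by blast
  have lin_T: "Vector_Spaces.linear scale scale T" and "bij T"
    using T by (simp_all add: GL_def)
  have lin_inv: "Vector_Spaces.linear scale scale (inv T)"
    using linear_inv_of_GL[OF vector_space_axioms T] .
  have inv_T: "inv T \<circ> T = id" and T_inv: "T \<circ> inv T = id"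
    using \<open>bij T\<close> by (simp_all add: bij_is_inj bij_is_surj flip: surj_iff)
  have intertwine: "inv T \<circ> \<psi> = \<phi> \<circ> inv T"
    unfolding \<psi> by (simp add: inv_T flip: comp_assoc)
  have w: "inv T v = w"
    unfolding v using fun_cong[OF inv_T, of w] by simp
  have "lie_iso (g_alg scale B \<phi> w d) (g_alg scale B \<psi> v d) (pullback scale B (inv T))"
    using bij_betw_pullback[OF lin_inv lin_T inv_T T_inv]
    unfolding lie_iso_def
    by (simp add: pullback_br[OF lin_inv assms(2) intertwine w])
      (simp add: g_alg_def pullback_simps)
  then show ?thesis
    unfolding lie_isomorphic_def
    using lie_algebra_g_alg[OF assms(2,4)] lie_algebra_g_alg[OF assms(3,5)] by blast
qed

end
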